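(* Let $\mathcal{P}$ be an $\mathrm{ASP^{fs}}$ program and $\mathcal{Q}$ a query that is finitely recursive on $\mathcal{P}$. Then $\mathrm{DMS}(\mathcal{Q},\mathcal{P})$ cautiously entails $\mathcal{Q}$ if and only if $\mathcal{P}$ cautiously entails $\mathcal{Q}$, and $\mathrm{DMS}(\mathcal{Q},\mathcal{P})$ bravely entails $\mathcal{Q}$ if and only if $\mathcal{P}$ bravely entails $\mathcal{Q}$.
   Context: Terms are variables or functional terms $f(t_1,\dots,t_k)$ ($k\ge0$; arity 0 gives constants). An atom is $p(t_1,\dots,t_k)$. A rule $r$: $a_1 \vee \dots \vee a_n \leftarrow b_1,\dots,b_j,\mathrm{not}\,b_{j+1},\dots,\mathrm{not}\,b_m$ ($n\ge1$); $H(r)$, $B^+(r)$, $B^-(r)$ are the head atoms, positive body atoms, negative body atoms, $\mathrm{atoms}(r)$ their union. A program is a finite set of rules; $p$ depends on $q$ if a rule has a $p$-atom in head and a $q$-atom in body (negatively if in $B^-$); stratified means no dependency cycle through a negative dependency. An $\mathrm{ASP^{fs}}$ program is a stratified program with disjunction and function symbols allowed. A fact is a rule with empty body, one head atom and no variables. A predicate is EDB if all its defining rules (rules with it in the head) are facts, IDB otherwise; $\mathrm{EDB}(\mathcal{P})$ is the set of rules of $\mathcal{P}$ with no IDB predicate in the head. Universe, base $B_\mathcal{P}$, $\mathrm{Ground}(\mathcal{P})$, models, reduct $\mathrm{Ground}(\mathcal{P})^I$ (delete ground rules with $B^-\cap I\neq\emptyset$, drop negative literals), and stable models (subset-minimal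 models $M$ of $\mathrm{Ground}(\mathcal{P})^M$) are as usual. A query is a ground atom $\mathcal{Q}=g(\bar t)$ with function symbols occurring in $\mathcal{P}$; cautious (brave) entailment means $\mathcal{Q}$ is in every (some) stable model. Relevant atoms for $\mathcal{Q}$: $\mathcal{Q}$, and all atoms of $\mathrm{atoms}(r_g)$ for $r_g\in\mathrm{Ground}(\mathcal{P})$ with a relevant head atom; $\mathcal{Q}$ is finitely recursive on $\mathcal{P}$ if finitely many ground atoms are relevant. The program $\mathrm{DMS}(\mathcal{Q},\mathcal{P})$: assume no predicate of $\mathcal{P}$ starts with "magic\_", and for each predicate $p$ let $\mathrm{magic\_}p$ be a fresh predicate of the same arity. Initialize $D=\emptyset$, $\mathit{modifiedRules}=\emptyset$, $\mathit{magicRules}=\{\mathrm{magic\_}g(\bar t).\}$, $S=\{g\}$. While $S\neq\emptyset$: remove a predicate $p$ from $S$ and add it to $D$; for each rule $r\in\mathcal{P}$ and each atom $p(\bar t)\in H(r)$: add to $\mathit{modifiedRules}$ the rule obtained from $r$ by adding to its body the atom $\mathrm{magic\_}q(\bar s)$ for every $q(\bar s)\in H(r)$; and for each atom $q(\bar s)\in\mathrm{atoms}(r)\setminus\{p(\bar t)\}$ with $q$ an IDB predicate, add the rule $\mathrm{magic\_}q(\bar s)\leftarrow \mathrm{magic\_}p(\bar t)$ to $\mathit{magicRules}$ and add $q$ to $S$ if $q\notin D$. Finally $\mathrm{DMS}(\mathcal{Q},\mathcal{P})=\mathit{magicRules}\cup\mathit{modifiedRules}\cup\mathrm{EDB}(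\mathcal{P})$.
   Formalization: DMS(Q,P) is grounded over the universe of P, not over its own: with unsafe rules allowed, the rewriting may lose constants of P and the claim fails (P = {q ← not r(X). r(a). d(b) ← e.}, query q). *)

theory Defs
  imports Main "HOL-Library.While_Combinator"
begin

text \<open>
  Function symbols and predicates are identified by their name together with their arity
  (\<open>f/k\<close>, \<open>p/k\<close>), so that no separate arity assumption is needed; a constant is a symbol \<open>f/0\<close>.
\<close>

datatype ('f, 'v) trm = Var 'v | Fun 'f "('f, 'v) trm list"

primrec vars_trm :: "('f, 'v) trm \<Rightarrow> 'v set" where
  "vars_trm (Var x) = {x}"
| "vars_trm (Fun f ts) = \<Union> (set (map vars_trm ts))"

primrec funs_trm :: "('f, 'v) trm \<Rightarrow> ('f \<times> nat) set" where
  "funs_trm (Var x) = {}"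
| "funs_trm (Fun f ts) = insert (f, length ts) (\<Union> (set (map funs_trm ts)))"

primrec subst_trm :: "('v \<Rightarrow> ('f, 'v) trm) \<Rightarrow> ('f, 'v) trm \<Rightarrow> ('f, 'v) trm" where
  "subst_trm \<sigma> (Var x) = \<sigma> x"
| "subst_trm \<sigma> (Fun f ts) = Fun f (map (subst_trm \<sigma>) ts)"

datatype ('p, 'f, 'v) atom = Atom (pname: 'p) (args: "('f, 'v) trm list")

definition pred :: "('p, 'f, 'v) atom \<Rightarrow> 'p \<times> nat" where
  "pred a = (pname a, length (args a))"

definition vars_atom :: "('p, 'f, 'v) atom \<Rightarrow> 'v set" where
  "vars_atom a = \<Union> (vars_trm ` set (args a))"

definition funs_atom :: "('p, 'f, 'v) atom \<Rightarrow> ('f \<times> nat) set" where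
  "funs_atom a = \<Union> (funs_trm ` set (args a))"

definition subst_atom :: "('v \<Rightarrow> ('f, 'v) trm) \<Rightarrow> ('p, 'f, 'v) atom \<Rightarrow> ('p, 'f, 'v) atom" where
  "subst_atom \<sigma> a = Atom (pname a) (map (subst_trm \<sigma>) (args a))"

datatype ('p, 'f, 'v) rule =
  Rule (head: "('p, 'f, 'v) atom set")
       (pos_body: "('p, 'f, 'v) atom set")
       (neg_body: "('p, 'f, 'v) atom set")

definition atoms :: "('p, 'f, 'v) rule \<Rightarrow> ('p, 'f, 'v) atom set" where
  "atoms r = head r \<union> pos_body r \<union> neg_body r"

definition subst_rule :: "('v \<Rightarrow> ('f, 'v) trm) \<Rightarrow> ('p, 'f, 'v) rule \<Rightarrow> ('p, 'f, 'v) rule" where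
  "subst_rule \<sigma> r =
     Rule (subst_atom \<sigma> ` head r) (subst_atom \<sigma> ` pos_body r) (subst_atom \<sigma> ` neg_body r)"

type_synonym ('p, 'f, 'v) program = "('p, 'f, 'v) rule set"

definition is_program :: "('p, 'f, 'v) program \<Rightarrow> bool" where
  "is_program P \<longleftrightarrow> finite P \<and> (\<forall>r\<in>P. finite (atoms r) \<and> head r \<noteq> {})"

definition preds :: "('p, 'f, 'v) program \<Rightarrow> ('p \<times> nat) set" where
  "preds P = (\<Union>r\<in>P. pred ` atoms r)"

definition funs :: "('p, 'f, 'v) program \<Rightarrow> ('f \<times> nat) set" where
  "funs P = (\<Union>r\<in>P. \<Union>a\<in>atoms r. funs_atom a)"


subsection \<open>Stratification\<close>

definition depends :: "('p, 'f, 'v) program \<Rightarrow> (('p \<times> nat) \<times> ('p \<times> nat)) set" where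
  "depends P = (\<Union>r\<in>P. (pred ` head r) \<times> (pred ` (pos_body r \<union> neg_body r)))"

definition depends_neg :: "('p, 'f, 'v) program \<Rightarrow> (('p \<times> nat) \<times> ('p \<times> nat)) set" where
  "depends_neg P = (\<Union>r\<in>P. (pred ` head r) \<times> (pred ` neg_body r))"

definition stratified :: "('p, 'f, 'v) program \<Rightarrow> bool" where
  "stratified P \<longleftrightarrow> (\<forall>(p, q)\<in>depends_neg P. (q, p) \<notin> (depends P)\<^sup>*)"

definition asp_fs :: "('p, 'f, 'v) program \<Rightarrow> bool" where
  "asp_fs P \<longleftrightarrow> is_program P \<and> stratified P"


subsection \<open>Extensional and intensional predicates\<close>

definition is_fact :: "('p, 'f, 'v) rule \<Rightarrow> bool" where
  "is_fact r \<longleftrightarrow> pos_body r = {} \<and> neg_body r = {} \<and> (\<exists>a. head r = {a} \<and> vars_atom a = {})"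

text \<open>A predicate without defining rules is extensional.\<close>

definition edb_pred :: "('p, 'f, 'v) program \<Rightarrow> 'p \<times> nat \<Rightarrow> bool" where
  "edb_pred P p \<longleftrightarrow> (\<forall>r\<in>P. p \<in> pred ` head r \<longrightarrow> is_fact r)"

abbreviation idb_pred :: "('p, 'f, 'v) program \<Rightarrow> 'p \<times> nat \<Rightarrow> bool" where
  "idb_pred P p \<equiv> \<not> edb_pred P p"

definition EDB :: "('p, 'f, 'v) program \<Rightarrow> ('p, 'f, 'v) program" where
  "EDB P = {r \<in> P. \<forall>a\<in>head r. \<not> idb_pred P (pred a)}"


subsection \<open>Grounding and stable models\<close>

text \<open>
  The Herbrand universe of \<open>P\<close>; as usual, an arbitrary constant \<open>c\<close> is added if
  no constant occurs in \<open>P\<close>.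
\<close>

definition universe :: "'f \<Rightarrow> ('p, 'f, 'v) program \<Rightarrow> ('f, 'v) trm set" where
  "universe c P = {t. vars_trm t = {} \<and>
     funs_trm t \<subseteq> (if \<exists>f. (f, 0) \<in> funs P then funs P else insert (c, 0) (funs P))}"

text \<open>
  The universe \<open>U\<close> over which a program is instantiated is kept as a parameter.  A program and its
  magic-set rewriting are read over the same language, namely that of the original program:
  the rewriting may discard rules that are irrelevant to the query together with function symbols
  occurring only in them, and since rules need not be safe, instantiating the rewriting over
  a smaller universe may change the answer.
\<close>

definition base :: "('f, 'v) trm set \<Rightarrow> ('p, 'f, 'v) program \<Rightarrow> ('p, 'f, 'v) atom set" where
  "base U P = {a. pred a \<in> preds P \<and> set (args a) \<subseteq> U}"

definition Ground :: "('f, 'v) trm set \<Rightarrow> ('p, 'f, 'v) program \<Rightarrow> ('p, 'f, 'v) program" where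
  "Ground U P = {subst_rule \<sigma> r | \<sigma> r. r \<in> P \<and> range \<sigma> \<subseteq> U}"

definition satisfies :: "('p, 'f, 'v) atom set \<Rightarrow> ('p, 'f, 'v) rule \<Rightarrow> bool" where
  "satisfies I r \<longleftrightarrow> (pos_body r \<subseteq> I \<and> neg_body r \<inter> I = {} \<longrightarrow> head r \<inter> I \<noteq> {})"

definition is_model :: "('p, 'f, 'v) program \<Rightarrow> ('p, 'f, 'v) atom set \<Rightarrow> bool" where
  "is_model G I \<longleftrightarrow> (\<forall>r\<in>G. satisfies I r)"

definition reduct :: "('p, 'f, 'v) program \<Rightarrow> ('p, 'f, 'v) atom set \<Rightarrow> ('p, 'f, 'v) program" where
  "reduct G I = {Rule (head r) (pos_body r) {} | r. r \<in> G \<and> neg_body r \<inter> I = {}}"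

definition stable_model ::
    "('f, 'v) trm set \<Rightarrow> ('p, 'f, 'v) program \<Rightarrow> ('p, 'f, 'v) atom set \<Rightarrow> bool" where
  "stable_model U P M \<longleftrightarrow>
     M \<subseteq> base U P \<and> is_model (reduct (Ground U P) M) M \<and>
     (\<forall>N. N \<subset> M \<longrightarrow> \<not> is_model (reduct (Ground U P) M) N)"


subsection \<open>Queries\<close>

definition is_query :: "('p, 'f, 'v) program \<Rightarrow> ('p, 'f, 'v) atom \<Rightarrow> bool" where
  "is_query P Q \<longleftrightarrow> vars_atom Q = {} \<and> funs_atom Q \<subseteq> funs P"

definition cautiously_entails ::
    "('f, 'v) trm set \<Rightarrow> ('p, 'f, 'v) program \<Rightarrow> ('p, 'f, 'v) atom \<Rightarrow> bool" where
  "cautiously_entails U P Q \<longleftrightarrow> (\<forall>M. stable_model U P M \<longrightarrow> Q \<in> M)"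

definition bravely_entails ::
    "('f, 'v) trm set \<Rightarrow> ('p, 'f, 'v) program \<Rightarrow> ('p, 'f, 'v) atom \<Rightarrow> bool" where
  "bravely_entails U P Q \<longleftrightarrow> (\<exists>M. stable_model U P M \<and> Q \<in> M)"

inductive_set relevant ::
    "('f, 'v) trm set \<Rightarrow> ('p, 'f, 'v) program \<Rightarrow> ('p, 'f, 'v) atom \<Rightarrow> ('p, 'f, 'v) atom set"
  for U P Q where
  query: "Q \<in> relevant U P Q"
| rule: "r \<in> Ground U P \<Longrightarrow> a \<in> head r \<Longrightarrow> a \<in> relevant U P Q \<Longrightarrow> b \<in> atoms r \<Longrightarrow>
    b \<in> relevant U P Q"

definition finitely_recursive ::
    "('f, 'v) trm set \<Rightarrow> ('p, 'f, 'v) program \<Rightarrow> ('p, 'f, 'v) atom \<Rightarrow> bool" where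
  "finitely_recursive U P Q \<longleftrightarrow> finite (relevant U P Q)"


subsection \<open>Dynamic magic sets\<close>

text \<open>
  The map \<open>magic\<close> sends a predicate name \<open>p\<close> to the name \<open>magic_p\<close>; arities are unchanged.
\<close>

definition fresh_magic ::
    "('p \<Rightarrow> 'p) \<Rightarrow> ('p, 'f, 'v) program \<Rightarrow> ('p, 'f, 'v) atom \<Rightarrow> bool" where
  "fresh_magic magic P Q \<longleftrightarrow>
     (let N = insert (pname Q) (fst ` preds P) in inj_on magic N \<and> magic ` N \<inter> N = {})"

definition magic_atom :: "('p \<Rightarrow> 'p) \<Rightarrow> ('p, 'f, 'v) atom \<Rightarrow> ('p, 'f, 'v) atom" where
  "magic_atom magic a = Atom (magic (pname a)) (args a)"

definition modified_rule :: "('p \<Rightarrow> 'p) \<Rightarrow> ('p, 'f, 'v) rule \<Rightarrow> ('p, 'f, 'v) rule" where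
  "modified_rule magic r =
     Rule (head r) (pos_body r \<union> magic_atom magic ` head r) (neg_body r)"

definition magic_rule ::
    "('p \<Rightarrow> 'p) \<Rightarrow> ('p, 'f, 'v) atom \<Rightarrow> ('p, 'f, 'v) atom \<Rightarrow> ('p, 'f, 'v) rule" where
  "magic_rule magic a b = Rule {magic_atom magic b} {magic_atom magic a} {}"

record ('p, 'f, 'v) dms_state =
  todo :: "('p \<times> nat) set"
  done_preds :: "('p \<times> nat) set"
  modified_rules :: "('p, 'f, 'v) program"
  magic_rules :: "('p, 'f, 'v) program"

definition dms_init :: "('p \<Rightarrow> 'p) \<Rightarrow> ('p, 'f, 'v) atom \<Rightarrow> ('p, 'f, 'v) dms_state" where
  "dms_init magic Q =
     \<lparr>todo = {pred Q}, done_preds = {}, modified_rules = {},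
      magic_rules = {Rule {magic_atom magic Q} {} {}}\<rparr>"

definition dms_process ::
    "('p \<Rightarrow> 'p) \<Rightarrow> ('p, 'f, 'v) program \<Rightarrow> 'p \<times> nat \<Rightarrow>
     ('p, 'f, 'v) dms_state \<Rightarrow> ('p, 'f, 'v) dms_state" where
  "dms_process magic P p s =
     (let D = insert p (done_preds s) in
      \<lparr>todo = (todo s - {p}) \<union>
         {pred b | r a b. r \<in> P \<and> a \<in> head r \<and> pred a = p \<and>
            b \<in> atoms r - {a} \<and> idb_pred P (pred b) \<and> pred b \<notin> D},
       done_preds = D,
       modified_rules = modified_rules s \<union>
         {modified_rule magic r | r a. r \<in> P \<and> a \<in> head r \<and> pred a = p},
       magic_rules = magic_rules s \<union>
         {magic_rule magic a b | r a b. r \<in> P \<and> a \<in> head r \<and> pred a = p \<and>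
            b \<in> atoms r - {a} \<and> idb_pred P (pred b)}\<rparr>)"

definition DMS ::
    "('p \<Rightarrow> 'p) \<Rightarrow> ('p, 'f, 'v) atom \<Rightarrow> ('p, 'f, 'v) program \<Rightarrow> ('p, 'f, 'v) program" where
  "DMS magic Q P =
     (let s = while (\<lambda>s. todo s \<noteq> {}) (\<lambda>s. dms_process magic P (SOME p. p \<in> todo s) s)
                (dms_init magic Q)
      in magic_rules s \<union> modified_rules s \<union> EDB P)"

end

theory Submission
  imports Defs
begin

text \<open>
  The ground atoms whose magic version is derivable, together with all atoms over extensional
  predicates, form a splitting set of the ground program: a ground rule with a head atom in the
  set has all its atoms in the set. Up to the derivable magic atoms, which do not depend on the
  choice of a stable model, the stable models of the rewriting are those of the bottom part of the
  ground program. Every stable model of the program restricts to one of the bottom part, and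
  conversely every stable model of the bottom part extends to one of the program: the strata are
  added one at a time, each time choosing by Zorn's lemma a minimal extension.
\<close>

subsection \<open>Stable models of ground programs\<close>

text \<open>Omits the condition of lying in the base, so that arbitrary sets of ground rules, such
  as a bottom part, can be treated; \<open>stable_model_iff\<close> restores the link.\<close>

definition stable :: "('p, 'f, 'v) program \<Rightarrow> ('p, 'f, 'v) atom set \<Rightarrow> bool" where
  "stable G M \<longleftrightarrow> is_model (reduct G M) M \<and> (\<forall>N. N \<subset> M \<longrightarrow> \<not> is_model (reduct G M) N)"

text \<open>The whole head has to lie in \<open>A\<close>: when strata separate the atoms of a
  disjunctive head, the rule enters only with its highest head atom.\<close>

definition bottom :: "('p, 'f, 'v) program \<Rightarrow> ('p, 'f, 'v) atom set \<Rightarrow> ('p, 'f, 'v) program" where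
  "bottom G A = {r \<in> G. head r \<subseteq> A}"

lemma is_model_reduct_iff:
  "is_model (reduct G I) J \<longleftrightarrow>
    (\<forall>r\<in>G. neg_body r \<inter> I = {} \<longrightarrow> pos_body r \<subseteq> J \<longrightarrow> head r \<inter> J \<noteq> {})"
  unfolding is_model_def reduct_def satisfies_def by fastforce

lemma is_model_reductD:
  "is_model (reduct G I) J \<Longrightarrow> r \<in> G \<Longrightarrow> neg_body r \<inter> I = {} \<Longrightarrow> pos_body r \<subseteq> J \<Longrightarrow>
    head r \<inter> J \<noteq> {}"
  unfolding is_model_reduct_iff by blast

lemma reduct_cong:
  assumes "\<And>r. r \<in> G \<Longrightarrow> neg_body r \<inter> I = neg_body r \<inter> I'"
  shows "reduct G I = reduct G I'"
  using assms unfolding reduct_def by blast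

text \<open>Discarding the atoms that head no rule preserves every rule of the reduct, so minimality
  forbids such atoms.\<close>

lemma stable_subset_heads:
  assumes "stable G M"
  shows "M \<subseteq> (\<Union>r\<in>G. head r)"
proof (rule ccontr)
  let ?N = "M \<inter> (\<Union>r\<in>G. head r)"
  assume "\<not> ?thesis"
  then have "?N \<subset> M" by blast
  moreover have "is_model (reduct G M) ?N"
    using assms unfolding stable_def is_model_reduct_iff by blast
  ultimately show False using assms unfolding stable_def by blast
qed

section \<open>Minimal models by Zorn's lemma\<close>

text \<open>Zorn's lemma yields maximal elements, so it is applied to the complements.\<close>

lemma minimal_set_exists:
  fixes F :: "'a set set"
  assumes "F \<noteq> {}"
    and "\<And>C. C \<noteq> {} \<Longrightarrow> subset.chain F C \<Longrightarrow> \<Inter>C \<in> F"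
  shows "\<exists>M\<in>F. \<forall>X\<in>F. X \<subseteq> M \<longrightarrow> X = M"
proof -
  have "\<exists>M\<in>uminus ` F. \<forall>X\<in>uminus ` F. M \<subseteq> X \<longrightarrow> X = M"
  proof (rule subset_Zorn_nonempty)
    show "uminus ` F \<noteq> {}" using assms(1) by simp
  next
    fix C assume C: "C \<noteq> {}" "subset.chain (uminus ` F) C"
    have "subset.chain F (uminus ` C)"
      using C(2) unfolding subset_chain_def by fastforce
    then have "\<Inter>(uminus ` C) \<in> F" using assms(2) C(1) by simp
    moreover have "\<Union>C = - \<Inter>(uminus ` C)" by auto
    ultimately show "\<Union>C \<in> uminus ` F" by blast
  qed
  then show ?thesis by auto
qed

text \<open>Finiteness of heads is decisive. If the intersection misses a head, each head atom is
  absent from some member of the chain; the least of these finitely many members contains no head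
  atom, yet it has to satisfy the rule.\<close>

lemma is_model_reduct_Inter_chain:
  assumes fin: "\<And>r. r \<in> G \<Longrightarrow> finite (head r)"
    and chain: "C \<noteq> {}" "subset.chain {Y. is_model (reduct G I) Y} C"
  shows "is_model (reduct G I) (\<Inter>C)"
  unfolding is_model_reduct_iff
proof (intro ballI impI notI)
  fix r assume r: "r \<in> G" "neg_body r \<inter> I = {}" "pos_body r \<subseteq> \<Inter>C" "head r \<inter> \<Inter>C = {}"
  have ne: "head r \<inter> Y \<noteq> {}" if Y: "Y \<in> C" for Y
  proof -
    have "is_model (reduct G I) Y" using chain(2) Y unfolding subset_chain_def by blast
    moreover have "pos_body r \<subseteq> Y" using r(3) Y by blast
    ultimately show ?thesis using r(1,2) unfolding is_model_reduct_iff by blast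
  qed
  have "\<forall>a\<in>head r. \<exists>Y\<in>C. a \<notin> Y" using r(4) by blast
  then obtain f where f: "\<And>a. a \<in> head r \<Longrightarrow> f a \<in> C \<and> a \<notin> f a" by metis
  have "head r \<noteq> {}" using ne chain(1) by blast
  moreover have "subset.chain {Y. is_model (reduct G I) Y} (f ` head r)"
    using chain(2) f unfolding subset_chain_def by blast
  \<comment> \<open>A finite nonempty chain contains its intersection.\<close>
  ultimately have "\<Inter>(f ` head r) \<in> f ` head r"
    using fin[OF r(1)] by (intro Inter_in_chain) auto
  then have "head r \<inter> \<Inter>(f ` head r) \<noteq> {}" using ne f by blast
  then show False using f by blast
qed

section \<open>Splitting a ground program\<close>

text \<open>The restriction half of splitting: a smaller model of the bottom part, joined with
  \<open>M - A\<close>, would be a smaller model of the whole reduct.\<close>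

lemma stable_bottom:
  assumes closed: "\<And>r. r \<in> G \<Longrightarrow> head r \<inter> A \<noteq> {} \<Longrightarrow> atoms r \<subseteq> A"
    and ne: "\<And>r. r \<in> G \<Longrightarrow> head r \<noteq> {}"
    and M: "stable G M"
  shows "stable (bottom G A) (M \<inter> A)"
proof -
  have cl: "head r \<subseteq> A \<and> pos_body r \<subseteq> A \<and> neg_body r \<subseteq> A" if "r \<in> bottom G A" for r
    using that closed[of r] ne[of r] unfolding bottom_def atoms_def by blast
  have red: "reduct (bottom G A) (M \<inter> A) = reduct (bottom G A) M"
    by (rule reduct_cong) (use cl in blast)
  have "is_model (reduct (bottom G A) M) (M \<inter> A)"
    using M cl unfolding stable_def is_model_reduct_iff bottom_def by blast
  moreover have "\<not> is_model (reduct (bottom G A) M) N" if N: "N \<subset> M \<inter> A" for N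
  proof
    assume mod: "is_model (reduct (bottom G A) M) N"
    have "is_model (reduct G M) (N \<union> (M - A))"
      unfolding is_model_reduct_iff
    proof (intro ballI impI)
      fix r assume r: "r \<in> G" "neg_body r \<inter> M = {}" "pos_body r \<subseteq> N \<union> (M - A)"
      show "head r \<inter> (N \<union> (M - A)) \<noteq> {}"
      proof (cases "head r \<inter> A = {}")
        case True
        have "pos_body r \<subseteq> M" using r N by blast
        then have "head r \<inter> M \<noteq> {}"
          using M r unfolding stable_def is_model_reduct_iff by blast
        then show ?thesis using True by blast
      next
        case False
        then have "atoms r \<subseteq> A" using closed r by blast
        then have "r \<in> bottom G A" "pos_body r \<subseteq> N"
          using r unfolding bottom_def atoms_def by auto
        then show ?thesis using mod r unfolding is_model_reduct_iff by blast
      qed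
    qed
    moreover have "N \<union> (M - A) \<subset> M" using N by blast
    ultimately show False using M unfolding stable_def by blast
  qed
  ultimately show ?thesis unfolding stable_def red by blast
qed

text \<open>Negation in the new stratum refers only to \<open>A\<close>, so the reduct is already
  determined by \<open>X\<close>. It then suffices to take a minimal model of this fixed reduct
  among those that agree with \<open>X\<close> on \<open>A\<close>.\<close>

lemma stable_extend_stratum:
  assumes AB: "A \<subseteq> B"
    and fin: "\<And>r. r \<in> G \<Longrightarrow> finite (head r)"
    and low: "\<And>r. r \<in> bottom G A \<Longrightarrow> atoms r \<subseteq> A"
    and up: "\<And>r. r \<in> bottom G B \<Longrightarrow> neg_body r \<subseteq> A"
    and X: "stable (bottom G A) X" "X \<subseteq> A"
  shows "\<exists>Y. stable (bottom G B) Y \<and> Y \<subseteq> B \<and> Y \<inter> A = X"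
proof -
  let ?H = "bottom G B"
  define F where "F = {Y. Y \<subseteq> B \<and> Y \<inter> A = X \<and> is_model (reduct ?H X) Y}"
  have lowd: "head r \<subseteq> A \<and> pos_body r \<subseteq> A \<and> neg_body r \<subseteq> A" if "r \<in> bottom G A" for r
    using low[OF that] unfolding atoms_def by blast
  \<comment> \<open>The largest candidate: a rule with a head atom outside \<open>A\<close> holds
    trivially, and every other rule belongs to the bottom part for \<open>A\<close>.\<close>
  have "is_model (reduct ?H X) (X \<union> (B - A))"
    unfolding is_model_reduct_iff
  proof (intro ballI impI)
    fix r assume r: "r \<in> ?H" "neg_body r \<inter> X = {}" "pos_body r \<subseteq> X \<union> (B - A)"
    show "head r \<inter> (X \<union> (B - A)) \<noteq> {}"
    proof (cases "head r \<subseteq> A")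
      case True
      then have rA: "r \<in> bottom G A" using r unfolding bottom_def by blast
      then have "pos_body r \<subseteq> X" using lowd r by blast
      then show ?thesis using X r rA unfolding stable_def is_model_reduct_iff by blast
    next
      case False
      then show ?thesis using r unfolding bottom_def by blast
    qed
  qed
  then have "X \<union> (B - A) \<in> F" using X AB unfolding F_def by blast
  then have "F \<noteq> {}" by blast
  moreover have "\<Inter>C \<in> F" if C: "C \<noteq> {}" "subset.chain F C" for C
  proof -
    have "subset.chain {Y. is_model (reduct ?H X) Y} C"
      using C(2) by (auto simp: subset_chain_def F_def)
    then have "is_model (reduct ?H X) (\<Inter>C)"
      using fin C(1) by (intro is_model_reduct_Inter_chain) (auto simp: bottom_def)
    moreover have "Y \<subseteq> B \<and> Y \<inter> A = X" if "Y \<in> C" for Y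
      using C(2) that by (auto simp: subset_chain_def F_def)
    then have "\<Inter>C \<subseteq> B" "\<Inter>C \<inter> A = X" using C(1) by blast+
    ultimately show ?thesis unfolding F_def by blast
  qed
  ultimately obtain Y where Y: "Y \<in> F" and min: "\<And>Z. Z \<in> F \<Longrightarrow> Z \<subseteq> Y \<Longrightarrow> Z = Y"
    using minimal_set_exists[of F] by blast
  have YB: "Y \<subseteq> B" "Y \<inter> A = X" "is_model (reduct ?H X) Y" using Y unfolding F_def by auto
  have red: "reduct ?H Y = reduct ?H X"
    by (rule reduct_cong) (use up YB in blast)
  have "\<not> is_model (reduct ?H X) N" if N: "N \<subset> Y" for N
  proof
    assume mod: "is_model (reduct ?H X) N"
    \<comment> \<open>\<open>Y\<close> is minimal only within \<open>F\<close>. A competitor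
      \<open>N\<close> is brought into \<open>F\<close> by stability of \<open>X\<close>, which
      forces \<open>N\<close> to agree with \<open>X\<close> on \<open>A\<close>.\<close>
    have "is_model (reduct (bottom G A) X) (N \<inter> A)"
      unfolding is_model_reduct_iff
    proof (intro ballI impI)
      fix r assume r: "r \<in> bottom G A" "neg_body r \<inter> X = {}" "pos_body r \<subseteq> N \<inter> A"
      then have "r \<in> ?H" using AB unfolding bottom_def by blast
      then have "head r \<inter> N \<noteq> {}" using r mod unfolding is_model_reduct_iff by blast
      then show "head r \<inter> (N \<inter> A) \<noteq> {}" using lowd r by blast
    qed
    moreover have "N \<inter> A \<subseteq> X" using N YB by blast
    ultimately have "N \<inter> A = X" using X unfolding stable_def by blast
    then have "N \<in> F" using mod N YB unfolding F_def by blast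
    then show False using min N by blast
  qed
  then show ?thesis using YB unfolding stable_def red[symmetric] by (metis red)
qed

text \<open>
  Only the dependencies of head atoms on body atoms are constrained: the atoms of a
  disjunctive head may lie in different strata.
\<close>

lemma stable_extend:
  fixes level :: "('p, 'f, 'v) atom \<Rightarrow> nat"
  assumes closed: "\<And>r. r \<in> G \<Longrightarrow> head r \<inter> A \<noteq> {} \<Longrightarrow> atoms r \<subseteq> A"
    and ne: "\<And>r. r \<in> G \<Longrightarrow> head r \<noteq> {}"
    and fin: "\<And>r. r \<in> G \<Longrightarrow> finite (head r)"
    and pos: "\<And>r a b. r \<in> G \<Longrightarrow> a \<in> head r \<Longrightarrow> b \<in> pos_body r \<Longrightarrow> level b \<le> level a"
    and neg: "\<And>r a b. r \<in> G \<Longrightarrow> a \<in> head r \<Longrightarrow> b \<in> neg_body r \<Longrightarrow> level b < level a"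
    and bound: "\<And>r a. r \<in> G \<Longrightarrow> a \<in> head r \<Longrightarrow> level a < n"
    and X: "stable (bottom G A) X" "X \<subseteq> A"
  shows "\<exists>M. stable G M \<and> M \<inter> A = X"
proof -
  \<comment> \<open>The growing splitting sets: \<open>S 0\<close> is \<open>A\<close>, and the
    bottom part for \<open>S n\<close> is all of \<open>G\<close>.\<close>
  define S where "S i = A \<union> {a. level a < i}" for i
  have S0: "S 0 = A" unfolding S_def by simp
  have closed_S: "atoms r \<subseteq> S i" if r: "r \<in> bottom G (S i)" for r i
  proof (cases "head r \<inter> A = {}")
    case True
    obtain a where a: "a \<in> head r" "r \<in> G" using ne r unfolding bottom_def by blast
    then have "level a < i" using True r unfolding bottom_def S_def by blast
    then have "pos_body r \<union> neg_body r \<subseteq> {b. level b < i}"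
      using pos[OF a(2,1)] neg[OF a(2,1)] by fastforce
    then show ?thesis using r unfolding bottom_def S_def atoms_def by blast
  next
    case False
    then show ?thesis using closed r unfolding bottom_def S_def by blast
  qed
  \<comment> \<open>The strict decrease of levels along negation pays for the shift from
    \<open>Suc i\<close> to \<open>i\<close>.\<close>
  have neg_S: "neg_body r \<subseteq> S i" if r: "r \<in> bottom G (S (Suc i))" for r i
  proof (cases "head r \<inter> A = {}")
    case True
    obtain a where a: "a \<in> head r" "r \<in> G" using ne r unfolding bottom_def by blast
    then have "level a \<le> i" using True r unfolding bottom_def S_def by auto
    then show ?thesis using neg[OF a(2,1)] unfolding S_def by fastforce
  next
    case False
    then show ?thesis using closed r unfolding bottom_def S_def atoms_def by blast
  qed
  have "\<exists>Y. stable (bottom G (S i)) Y \<and> Y \<subseteq> S i \<and> Y \<inter> A = X" for i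
  proof (induction i)
    case 0
    then show ?case using X S0 by (metis inf.absorb1)
  next
    case (Suc i)
    then obtain Y where Y: "stable (bottom G (S i)) Y" "Y \<subseteq> S i" "Y \<inter> A = X" by blast
    have "S i \<subseteq> S (Suc i)" unfolding S_def by auto
    then obtain Z where Z: "stable (bottom G (S (Suc i))) Z" "Z \<subseteq> S (Suc i)" "Z \<inter> S i = Y"
      using stable_extend_stratum[OF _ fin closed_S neg_S Y(1,2)] by blast
    moreover have "Z \<inter> A = X" using Z(3) Y(3) unfolding S_def by blast
    ultimately show ?case by blast
  qed
  moreover have "bottom G (S n) = G" using bound unfolding bottom_def S_def by blast
  ultimately show ?thesis by metis
qed

subsection \<open>Grounding\<close>

text \<open>Atoms of a stable set occur in heads, so the base condition holds automatically once all
  heads lie in the base.\<close>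

lemma stable_model_iff:
  assumes "\<And>r. r \<in> Ground U P \<Longrightarrow> head r \<subseteq> base U P"
  shows "stable_model U P M \<longleftrightarrow> stable (Ground U P) M"
proof -
  have "M \<subseteq> base U P" if "stable (Ground U P) M"
    using stable_subset_heads[OF that] assms by blast
  then show ?thesis unfolding stable_model_def stable_def by blast
qed

lemma pred_subst_atom [simp]: "pred (subst_atom \<sigma> a) = pred a"
  unfolding pred_def subst_atom_def by simp

lemma pname_subst_atom [simp]: "pname (subst_atom \<sigma> a) = pname a"
  unfolding subst_atom_def by simp

lemma subst_rule_sel [simp]:
  "head (subst_rule \<sigma> r) = subst_atom \<sigma> ` head r"
  "pos_body (subst_rule \<sigma> r) = subst_atom \<sigma> ` pos_body r"
  "neg_body (subst_rule \<sigma> r) = subst_atom \<sigma> ` neg_body r"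
  unfolding subst_rule_def by simp_all

lemma atoms_subst_rule [simp]: "atoms (subst_rule \<sigma> r) = subst_atom \<sigma> ` atoms r"
  unfolding atoms_def by auto

lemma subst_trm_ground: "vars_trm t = {} \<Longrightarrow> subst_trm \<sigma> t = t"
  by (induction t) (auto intro: map_idI)

lemma subst_atom_ground: "vars_atom a = {} \<Longrightarrow> subst_atom \<sigma> a = a"
  by (cases a) (auto simp: vars_atom_def subst_atom_def subst_trm_ground intro: map_idI)

lemma universe_nonempty: "universe c P \<noteq> {}"
proof (cases "\<exists>f. (f, 0) \<in> funs P")
  case True
  then obtain f where "(f, 0) \<in> funs P" by blast
  then have "Fun f [] \<in> universe c P" unfolding universe_def by auto
  then show ?thesis by blast
next
  case False
  then have "Fun c [] \<in> universe c P" unfolding universe_def by auto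
  then show ?thesis by blast
qed

lemma subst_trm_in_universe:
  assumes "range \<sigma> \<subseteq> universe c P" "funs_trm t \<subseteq> funs P"
  shows "subst_trm \<sigma> t \<in> universe c P"
  using assms(2)
proof (induction t)
  case (Var x)
  then show ?case using assms(1) by auto
next
  case (Fun f ts)
  then have "\<forall>t\<in>set ts. subst_trm \<sigma> t \<in> universe c P" by fastforce
  then show ?case using Fun.prems unfolding universe_def by (auto split: if_splits)
qed

lemma args_subst_atom_in_universe:
  assumes "range \<sigma> \<subseteq> universe c P" "funs_atom a \<subseteq> funs P"
  shows "set (args (subst_atom \<sigma> a)) \<subseteq> universe c P"
  using assms(2)
  by (auto simp: subst_atom_def funs_atom_def UN_subset_iff
      intro!: subst_trm_in_universe[OF assms(1)])

text \<open>Stated for two programs because the rewriting \<open>R\<close> is instantiated over the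
  universe of the original program \<open>P\<close>.\<close>

lemma Ground_head_base:
  assumes "\<And>r a. r \<in> R \<Longrightarrow> a \<in> head r \<Longrightarrow> funs_atom a \<subseteq> funs P"
    and "r \<in> Ground (universe c P) R"
  shows "head r \<subseteq> base (universe c P) R"
proof
  fix a assume "a \<in> head r"
  then obtain \<sigma> r' a' where *: "r' \<in> R" "range \<sigma> \<subseteq> universe c P" "a' \<in> head r'"
      "a = subst_atom \<sigma> a'"
    using assms(2) unfolding Ground_def by auto
  then have "pred a \<in> preds R" unfolding preds_def atoms_def by force
  then show "a \<in> base (universe c P) R"
    using args_subst_atom_in_universe[OF *(2) assms(1)[OF *(1,3)]] *(4) unfolding base_def by simp
qed

lemma funs_atom_subset_funs: "r \<in> P \<Longrightarrow> a \<in> atoms r \<Longrightarrow> funs_atom a \<subseteq> funs P"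
  unfolding funs_def by blast

lemma Ground_pname: "r \<in> Ground U P \<Longrightarrow> a \<in> atoms r \<Longrightarrow> pname a \<in> fst ` preds P"
  unfolding Ground_def preds_def pred_def by (force simp: image_iff)

text \<open>Substitution preserves predicates, so the rule instantiated here is itself a fact of
  \<open>EDB P\<close>.\<close>

lemma Ground_edb:
  assumes "r \<in> Ground U P" "a \<in> head r" "edb_pred P (pred a)"
  shows "head r = {a} \<and> pos_body r = {} \<and> neg_body r = {} \<and> r \<in> Ground U (EDB P)"
proof -
  obtain \<sigma> r' where r: "r' \<in> P" "range \<sigma> \<subseteq> U" "r = subst_rule \<sigma> r'"
    using assms(1) unfolding Ground_def by blast
  then obtain a' where a': "a' \<in> head r'" "a = subst_atom \<sigma> a'" using assms(2) by auto
  then have "is_fact r'" using assms(3) r(1) unfolding edb_pred_def by auto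
  then have "head r' = {a'}" "pos_body r' = {}" "neg_body r' = {}"
    using a' unfolding is_fact_def by auto
  moreover from this have "r' \<in> EDB P" using assms(3) a' r(1) unfolding EDB_def by simp
  ultimately show ?thesis using r a' unfolding Ground_def by auto
qed

section \<open>Strata of predicates\<close>

text \<open>An explicit level mapping: the reachable set shrinks along dependencies, and strictly
  along negative ones.\<close>

definition stratum :: "('p, 'f, 'v) program \<Rightarrow> 'p \<times> nat \<Rightarrow> nat" where
  "stratum P p = card {q. (p, q) \<in> (depends P)\<^sup>*}"

lemma finite_preds: "is_program P \<Longrightarrow> finite (preds P)"
  unfolding is_program_def preds_def by auto

lemma reachable_preds: "{q. (p, q) \<in> (depends P)\<^sup>*} \<subseteq> insert p (preds P)"
proof -
  have "q = p \<or> q \<in> preds P" if "(p, q) \<in> (depends P)\<^sup>*" for q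
    using that by cases (auto simp: depends_def preds_def atoms_def)
  then show ?thesis by blast
qed

lemma finite_reachable: "is_program P \<Longrightarrow> finite {q. (p, q) \<in> (depends P)\<^sup>*}"
  using finite_subset[OF reachable_preds] finite_preds by blast

text \<open>The summand 2 accounts for \<open>p\<close> itself, which reaches itself even outside
  \<open>preds P\<close>, and for the strict inequality.\<close>

lemma stratum_bound:
  assumes "is_program P"
  shows "stratum P p < card (preds P) + 2"
proof -
  have "stratum P p \<le> card (insert p (preds P))"
    unfolding stratum_def by (intro card_mono reachable_preds) (simp add: finite_preds assms)
  also have "\<dots> \<le> card (preds P) + 1" by (simp add: card_insert_if finite_preds assms)
  finally show ?thesis by simp
qed

lemma stratum_mono:
  assumes "is_program P" "(p, q) \<in> depends P"
  shows "stratum P q \<le> stratum P p"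
  unfolding stratum_def using assms
  by (intro card_mono finite_reachable) (auto intro: converse_rtrancl_into_rtrancl)

lemma stratum_strict_mono:
  assumes "is_program P" "stratified P" "(p, q) \<in> depends_neg P"
  shows "stratum P q < stratum P p"
  unfolding stratum_def
proof (intro psubset_card_mono finite_reachable assms(1) psubsetI)
  have "(p, q) \<in> depends P" using assms(3) unfolding depends_def depends_neg_def by blast
  then show "{r. (q, r) \<in> (depends P)\<^sup>*} \<subseteq> {r. (p, r) \<in> (depends P)\<^sup>*}"
    by (auto intro: converse_rtrancl_into_rtrancl)
  \<comment> \<open>The sets differ at \<open>p\<close>: it reaches itself, but stratification
    prevents \<open>q\<close> from reaching it.\<close>
  show "{r. (q, r) \<in> (depends P)\<^sup>*} \<noteq> {r. (p, r) \<in> (depends P)\<^sup>*}"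
    using assms(2,3) unfolding stratified_def by auto
qed

lemma Ground_depends:
  assumes "r \<in> Ground U P" "a \<in> head r"
  shows "b \<in> pos_body r \<Longrightarrow> (pred a, pred b) \<in> depends P"
    and "b \<in> neg_body r \<Longrightarrow> (pred a, pred b) \<in> depends_neg P"
  using assms unfolding Ground_def depends_def depends_neg_def by force+

lemma Ground_head:
  assumes "is_program P" "r \<in> Ground U P"
  shows "head r \<noteq> {}" "finite (head r)"
  using assms unfolding Ground_def is_program_def atoms_def by auto

text \<open>The extension half of splitting, with the level of an atom given by the stratum of its
  predicate.\<close>

lemma stable_Ground_extend:
  assumes P: "asp_fs P"
    and closed: "\<And>r. r \<in> Ground U P \<Longrightarrow> head r \<inter> A \<noteq> {} \<Longrightarrow> atoms r \<subseteq> A"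
    and X: "stable (bottom (Ground U P) A) X" "X \<subseteq> A"
  shows "\<exists>M. stable (Ground U P) M \<and> M \<inter> A = X"
proof -
  have prog: "is_program P" "stratified P" using P unfolding asp_fs_def by auto
  show ?thesis
    by (rule stable_extend[where level = "\<lambda>a. stratum P (pred a)" and n = "card (preds P) + 2"])
      (use closed X prog Ground_head[of P _ U] Ground_depends[of _ U P] stratum_mono[of P]
        stratum_strict_mono[of P] stratum_bound[of P] in \<open>auto\<close>)
qed

subsection \<open>The rules of the rewriting\<close>

definition magic_step ::
    "('p \<Rightarrow> 'p) \<Rightarrow> ('p, 'f, 'v) program \<Rightarrow> ('p \<times> nat) set \<Rightarrow> ('p, 'f, 'v) program" where
  "magic_step magic P D = {magic_rule magic a b | r a b. r \<in> P \<and> a \<in> head r \<and> pred a \<in> D \<and>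
     b \<in> atoms r - {a} \<and> idb_pred P (pred b)}"

definition modified_step ::
    "('p \<Rightarrow> 'p) \<Rightarrow> ('p, 'f, 'v) program \<Rightarrow> ('p \<times> nat) set \<Rightarrow> ('p, 'f, 'v) program" where
  "modified_step magic P D = {modified_rule magic r | r a. r \<in> P \<and> a \<in> head r \<and> pred a \<in> D}"

text \<open>Two sets are kept so that this can serve as a loop invariant: \<open>D\<close> holds the
  processed predicates, \<open>E\<close> also those still waiting. At exit both coincide.\<close>

definition idb_closed :: "('p, 'f, 'v) program \<Rightarrow> ('p \<times> nat) set \<Rightarrow> ('p \<times> nat) set \<Rightarrow> bool" where
  "idb_closed P D E \<longleftrightarrow> (\<forall>r\<in>P. \<forall>a\<in>head r. pred a \<in> D \<longrightarrow>
     (\<forall>b\<in>atoms r - {a}. idb_pred P (pred b) \<longrightarrow> pred b \<in> E))"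

text \<open>Replaces the loop by a closed form. Of the set \<open>D\<close> of processed predicates,
  only closure and membership of the query predicate are recorded.\<close>

lemma DMS_rules:
  fixes P :: "('p, 'f, 'v) program" and Q :: "('p, 'f, 'v) atom"
  assumes P: "is_program P"
  obtains D where "pred Q \<in> D" "idb_closed P D D"
    "DMS magic Q P = insert (Rule {magic_atom magic Q} {} {}) (magic_step magic P D) \<union>
       modified_step magic P D \<union> EDB P"
proof -
  let ?N = "insert (pred Q) (preds P)"
  define inv where "inv s \<longleftrightarrow> todo s \<union> done_preds s \<subseteq> ?N \<and> todo s \<inter> done_preds s = {} \<and>
    pred Q \<in> todo s \<union> done_preds s \<and>
    idb_closed P (done_preds s) (todo s \<union> done_preds s) \<and>
    magic_rules s = insert (Rule {magic_atom magic Q} {} {}) (magic_step magic P (done_preds s)) \<and>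
    modified_rules s = modified_step magic P (done_preds s)"
    for s :: "('p, 'f, 'v) dms_state"
  let ?body = "\<lambda>s. dms_process magic P (SOME p. p \<in> todo s) s"
  define s where "s = while (\<lambda>s. todo s \<noteq> {}) ?body (dms_init magic Q)"
  have step: "inv (dms_process magic P p s) \<and>
      card (?N - done_preds (dms_process magic P p s)) < card (?N - done_preds s)"
    if inv: "inv s" and p: "p \<in> todo s" for s p
  proof -
    let ?t = "dms_process magic P p s"
    have d: "done_preds ?t = insert p (done_preds s)"
      unfolding dms_process_def Let_def by simp
    have t: "todo ?t = (todo s - {p}) \<union>
         {pred b | r a b. r \<in> P \<and> a \<in> head r \<and> pred a = p \<and>
            b \<in> atoms r - {a} \<and> idb_pred P (pred b) \<and> pred b \<notin> insert p (done_preds s)}"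
      unfolding dms_process_def Let_def by simp
    have "magic_rules ?t = magic_rules s \<union> magic_step magic P {p}"
      unfolding dms_process_def Let_def magic_step_def by simp
    moreover have "magic_step magic P (insert p (done_preds s)) =
        magic_step magic P (done_preds s) \<union> magic_step magic P {p}"
      unfolding magic_step_def by blast
    ultimately have mg: "magic_rules ?t = insert (Rule {magic_atom magic Q} {} {})
        (magic_step magic P (done_preds ?t))"
      using inv d unfolding inv_def by simp
    have "modified_rules ?t = modified_rules s \<union> modified_step magic P {p}"
      unfolding dms_process_def Let_def modified_step_def by simp
    moreover have "modified_step magic P (insert p (done_preds s)) =
        modified_step magic P (done_preds s) \<union> modified_step magic P {p}"
      unfolding modified_step_def by blast
    ultimately have md: "modified_rules ?t = modified_step magic P (done_preds ?t)"
      using inv d unfolding inv_def by simp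
    have "todo ?t \<union> done_preds ?t \<subseteq> ?N"
      using inv p unfolding d t inv_def preds_def by auto
    moreover have "todo ?t \<inter> done_preds ?t = {}" "pred Q \<in> todo ?t \<union> done_preds ?t"
      using inv p unfolding d t inv_def by auto
    moreover have "idb_closed P (done_preds ?t) (todo ?t \<union> done_preds ?t)"
      unfolding idb_closed_def
    proof (intro ballI impI)
      fix r a b
      assume *: "r \<in> P" "a \<in> head r" "pred a \<in> done_preds ?t" "b \<in> atoms r - {a}"
        "idb_pred P (pred b)"
      show "pred b \<in> todo ?t \<union> done_preds ?t"
      proof (cases "pred a = p")
        case True
        then show ?thesis using * unfolding d t by blast
      next
        case False
        then have "pred b \<in> todo s \<union> done_preds s"
          using * inv unfolding d inv_def idb_closed_def by blast
        then show ?thesis unfolding d t by blast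
      qed
    qed
    \<comment> \<open>Termination: \<open>p\<close> lies in \<open>?N\<close> and, since waiting and
      processed predicates are disjoint, was not processed before.\<close>
    moreover have "card (?N - done_preds ?t) < card (?N - done_preds s)"
      by (rule psubset_card_mono) (use inv p finite_preds[OF P] d in \<open>auto simp: inv_def\<close>)
    ultimately show ?thesis using mg md unfolding inv_def by blast
  qed
  have some: "(SOME p. p \<in> todo s) \<in> todo s" if "todo s \<noteq> {}"
    for s :: "('p, 'f, 'v) dms_state"
    using that by (simp add: some_in_eq)
  have "inv s \<and> todo s = {}"
    unfolding s_def
  proof (rule while_rule[where P = inv and r = "measure (\<lambda>s. card (?N - done_preds s))"])
    show "inv (dms_init magic Q)"
      unfolding inv_def dms_init_def idb_closed_def magic_step_def modified_step_def by auto
  next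
    fix s assume "inv s" "todo s \<noteq> {}"
    then show "inv (?body s)" using step some by blast
  next
    fix s assume "inv s" "todo s \<noteq> {}"
    then show "(?body s, s) \<in> measure (\<lambda>s. card (?N - done_preds s))"
      using step some by simp
  qed auto
  moreover have "DMS magic Q P = magic_rules s \<union> modified_rules s \<union> EDB P"
    unfolding DMS_def s_def by (simp add: Let_def)
  ultimately show thesis using that[of "done_preds s"] unfolding inv_def by auto
qed

lemma subst_magic_atom: "subst_atom \<sigma> (magic_atom magic a) = magic_atom magic (subst_atom \<sigma> a)"
  unfolding magic_atom_def subst_atom_def by simp

lemma subst_magic_rule:
  "subst_rule \<sigma> (magic_rule magic a b) = magic_rule magic (subst_atom \<sigma> a) (subst_atom \<sigma> b)"
  unfolding magic_rule_def subst_rule_def by (simp add: subst_magic_atom)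

lemma subst_modified_rule:
  "subst_rule \<sigma> (modified_rule magic r) = modified_rule magic (subst_rule \<sigma> r)"
  unfolding modified_rule_def subst_rule_def by (auto simp: image_Un image_image subst_magic_atom)

lemma magic_rule_sel [simp]:
  "head (magic_rule magic a b) = {magic_atom magic b}"
  "pos_body (magic_rule magic a b) = {magic_atom magic a}"
  "neg_body (magic_rule magic a b) = {}"
  unfolding magic_rule_def by simp_all

lemma modified_rule_sel [simp]:
  "head (modified_rule magic r) = head r"
  "pos_body (modified_rule magic r) = pos_body r \<union> magic_atom magic ` head r"
  "neg_body (modified_rule magic r) = neg_body r"
  unfolding modified_rule_def by simp_all

subsection \<open>Stable models of the rewriting\<close>

text \<open>Relevance as the magic rules propagate it: only intensional atoms are passed on,
  although \<open>Q\<close> itself may be extensional.\<close>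

inductive_set idb_relevant ::
    "('f, 'v) trm set \<Rightarrow> ('p, 'f, 'v) program \<Rightarrow> ('p, 'f, 'v) atom \<Rightarrow> ('p, 'f, 'v) atom set"
  for U P Q where
  query: "Q \<in> idb_relevant U P Q"
| rule: "r \<in> Ground U P \<Longrightarrow> a \<in> head r \<Longrightarrow> a \<in> idb_relevant U P Q \<Longrightarrow> b \<in> atoms r \<Longrightarrow>
    idb_pred P (pred b) \<Longrightarrow> b \<in> idb_relevant U P Q"

text \<open>Extensional atoms are added because bodies of relevant rules may contain them; the rules
  defining them are facts, so closure survives.\<close>

definition split_set ::
    "('f, 'v) trm set \<Rightarrow> ('p, 'f, 'v) program \<Rightarrow> ('p, 'f, 'v) atom \<Rightarrow> ('p, 'f, 'v) atom set" where
  "split_set U P Q = idb_relevant U P Q \<union> {a. edb_pred P (pred a)}"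

lemma split_set_closed:
  assumes "r \<in> Ground U P" "head r \<inter> split_set U P Q \<noteq> {}"
  shows "atoms r \<subseteq> split_set U P Q"
proof -
  obtain a where a: "a \<in> head r" "a \<in> split_set U P Q" using assms(2) by blast
  show ?thesis
  proof (cases "edb_pred P (pred a)")
    case True
    then have "atoms r = {a}" using Ground_edb assms(1) a(1) unfolding atoms_def by blast
    then show ?thesis using a by simp
  next
    case False
    then have "a \<in> idb_relevant U P Q" using a(2) unfolding split_set_def by blast
    then show ?thesis using idb_relevant.rule[OF assms(1) a(1)] unfolding split_set_def by blast
  qed
qed

locale magic_sets =
  fixes U :: "('f, 'v) trm set" and P :: "('p, 'f, 'v) program" and Q :: "('p, 'f, 'v) atom"
    and magic :: "'p \<Rightarrow> 'p"
  assumes program: "is_program P"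
    and fresh: "fresh_magic magic P Q"
    and ground_Q: "vars_atom Q = {}"
    and U_nonempty: "U \<noteq> {}"
begin

abbreviation "G \<equiv> Ground U P"
abbreviation "GD \<equiv> Ground U (DMS magic Q P)"
abbreviation "R \<equiv> idb_relevant U P Q"
abbreviation "GB \<equiv> bottom G (split_set U P Q)"
abbreviation "names \<equiv> insert (pname Q) (fst ` preds P)"
text \<open>These turn out to be exactly the magic atoms of every stable model of
  \<open>GD\<close>.\<close>

abbreviation "K \<equiv> magic_atom magic ` R"

text \<open>All atoms with a magic name, derivable or not; subtracting them recovers the part over
  the original language.\<close>

definition magic_atoms :: "('p, 'f, 'v) atom set" where
  "magic_atoms = {a. pname a \<in> magic ` names}"

lemma fresh_disjoint: "n \<in> names \<Longrightarrow> n \<notin> magic ` names"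
  using fresh unfolding fresh_magic_def Let_def by (meson disjoint_iff)

lemma G_nonmagic: "r \<in> G \<Longrightarrow> atoms r \<inter> magic_atoms = {}"
  using fresh_disjoint Ground_pname[of r U P] unfolding magic_atoms_def by blast

lemma Q_nonmagic: "Q \<notin> magic_atoms"
  using fresh_disjoint unfolding magic_atoms_def by auto

lemma R_names: "a \<in> R \<Longrightarrow> pname a \<in> names"
  by (induction rule: idb_relevant.induct) (auto dest: Ground_pname)

lemma K_magic: "K \<subseteq> magic_atoms"
proof
  fix b assume "b \<in> K"
  then obtain a where "a \<in> R" "b = magic_atom magic a" by blast
  moreover from this have "magic (pname a) \<in> magic ` names" using R_names by (intro imageI)
  ultimately show "b \<in> magic_atoms" unfolding magic_atoms_def magic_atom_def by simp
qed

text \<open>Injectivity of \<open>magic\<close> on the occurring names allows an atom to be read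
  back from its magic version.\<close>

lemma magic_atom_in_K_iff:
  assumes "pname a \<in> names"
  shows "magic_atom magic a \<in> K \<longleftrightarrow> a \<in> R"
proof
  assume "magic_atom magic a \<in> K"
  then obtain b where b: "b \<in> R" "magic_atom magic a = magic_atom magic b" by blast
  then have "magic (pname a) = magic (pname b)" "args a = args b"
    unfolding magic_atom_def by auto
  moreover have "inj_on magic names" using fresh unfolding fresh_magic_def Let_def by blast
  ultimately have "a = b" using assms R_names[OF b(1)] by (metis atom.expand inj_onD)
  then show "a \<in> R" using b by simp
qed simp

text \<open>An extensional head atom comes from a fact and is therefore the only one, namely
  \<open>a\<close>. Hence all magic atoms added to the body of a relevant rule lie in
  \<open>K\<close>.\<close>

lemma head_in_R:
  assumes "r \<in> G" "a \<in> head r" "a \<in> R"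
  shows "head r \<subseteq> R"
proof
  fix b assume b: "b \<in> head r"
  show "b \<in> R"
  proof (cases "edb_pred P (pred b)")
    case True
    then show ?thesis using Ground_edb[OF assms(1) b] assms by auto
  next
    case False
    then show ?thesis using idb_relevant.rule[OF assms] b unfolding atoms_def by blast
  qed
qed

section \<open>Ground rules of the rewriting\<close>

text \<open>An upper bound on \<open>GD\<close> that forgets which predicates were processed; this
  is enough for verifying that a set is a model. \<open>GD_query\<close>, \<open>GD_rules\<close>
  and \<open>GD_edb\<close> supply the lower bounds.\<close>

lemma GD_cases:
  assumes "r \<in> GD"
  obtains (query) "r = Rule {magic_atom magic Q} {} {}"
  | (magic) r' a b where "r' \<in> G" "a \<in> head r'" "b \<in> atoms r'" "idb_pred P (pred b)"
      "r = magic_rule magic a b"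
  | (modified) r' where "r' \<in> G" "r = modified_rule magic r'"
  | (edb) "r \<in> GB"
proof -
  obtain D where D: "DMS magic Q P = insert (Rule {magic_atom magic Q} {} {})
      (magic_step magic P D) \<union> modified_step magic P D \<union> EDB P"
    using DMS_rules[OF program] by metis
  obtain \<sigma> r0 where r: "r0 \<in> DMS magic Q P" "range \<sigma> \<subseteq> U" "r = subst_rule \<sigma> r0"
    using assms unfolding Ground_def by blast
  have inG: "subst_rule \<sigma> r' \<in> G" if "r' \<in> P" for r' using that r(2) unfolding Ground_def by blast
  from r(1) consider "r0 = Rule {magic_atom magic Q} {} {}" | "r0 \<in> magic_step magic P D"
    | "r0 \<in> modified_step magic P D" | "r0 \<in> EDB P" unfolding D by blast
  then show thesis
  proof cases
    case 1
    then show ?thesis using query r(3) ground_Q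
      by (simp add: subst_rule_def subst_magic_atom subst_atom_ground)
  next
    case 2
    then obtain r' a b where *: "r' \<in> P" "a \<in> head r'" "b \<in> atoms r'" "idb_pred P (pred b)"
        "r0 = magic_rule magic a b"
      unfolding magic_step_def by blast
    show ?thesis
      by (rule magic[OF inG[OF *(1)], of "subst_atom \<sigma> a" "subst_atom \<sigma> b"])
        (use * r(3) in \<open>auto simp: subst_magic_rule\<close>)
  next
    case 3
    then obtain r' where "r' \<in> P" "r0 = modified_rule magic r'" unfolding modified_step_def by blast
    then show ?thesis using modified[OF inG] r(3) by (simp add: subst_modified_rule)
  next
    case 4
    then have "r \<in> GB" using inG r(3) unfolding EDB_def bottom_def split_set_def by auto
    then show ?thesis by (rule edb)
  qed
qed

lemma GD_query: "Rule {magic_atom magic Q} {} {} \<in> GD"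
proof -
  \<comment> \<open>Even a variable-free rule is instantiated only if some substitution into
    \<open>U\<close> exists.\<close>
  obtain u where "u \<in> U" using U_nonempty by blast
  then have "range (\<lambda>_. u) \<subseteq> U" by blast
  moreover have "Rule {magic_atom magic Q} {} {} \<in> DMS magic Q P"
    using DMS_rules[OF program, of Q magic] by blast
  moreover have "subst_rule (\<lambda>_. u) (Rule {magic_atom magic Q} {} {}) =
      Rule {magic_atom magic Q} {} {}"
    using ground_Q by (simp add: subst_rule_def subst_magic_atom subst_atom_ground)
  ultimately show ?thesis unfolding Ground_def by force
qed

lemma GD_rules:
  assumes "r \<in> G" "a \<in> head r" "a \<in> R"
  shows "b \<in> atoms r \<Longrightarrow> idb_pred P (pred b) \<Longrightarrow> b \<noteq> a \<Longrightarrow> magic_rule magic a b \<in> GD"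
    and "modified_rule magic r \<in> GD"
proof -
  obtain D where D: "pred Q \<in> D" "idb_closed P D D" "DMS magic Q P =
      insert (Rule {magic_atom magic Q} {} {}) (magic_step magic P D) \<union>
      modified_step magic P D \<union> EDB P"
    using DMS_rules[OF program] by metis
  \<comment> \<open>Ground relevance stays within the processed predicates, since each of its steps
    instantiates a step covered by \<open>idb_closed\<close>.\<close>
  have "pred a \<in> D" using assms(3)
  proof (induction rule: idb_relevant.induct)
    case query
    then show ?case using D by simp
  next
    case (rule r a b)
    then obtain \<sigma> r0 a0 b0 where "r0 \<in> P" "a0 \<in> head r0" "a = subst_atom \<sigma> a0" "b0 \<in> atoms r0"
        "b = subst_atom \<sigma> b0"
      unfolding Ground_def by auto
    then show ?case using rule D(2) unfolding idb_closed_def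
      \<comment> \<open>Closure excludes the head atom itself; in that case both predicates
        coincide.\<close>
      by (cases "a0 = b0") (auto dest!: bspec)
  qed
  moreover obtain \<sigma> r0 a0 where r0: "r0 \<in> P" "range \<sigma> \<subseteq> U" "r = subst_rule \<sigma> r0" "a0 \<in> head r0"
      "a = subst_atom \<sigma> a0"
    using assms(1,2) unfolding Ground_def by auto
  ultimately have aD: "pred a0 \<in> D" by simp
  have "modified_rule magic r0 \<in> DMS magic Q P"
    unfolding D modified_step_def using r0 aD by blast
  then show "modified_rule magic r \<in> GD"
    using r0(2,3) unfolding Ground_def by (auto simp: subst_modified_rule[symmetric])
  show "magic_rule magic a b \<in> GD" if b: "b \<in> atoms r" "idb_pred P (pred b)" "b \<noteq> a"
  proof -
    obtain b0 where b0: "b0 \<in> atoms r0" "b = subst_atom \<sigma> b0" using b(1) r0(3) by auto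
    then have "magic_rule magic a0 b0 \<in> DMS magic Q P"
      unfolding D magic_step_def using r0 aD b by auto
    then show ?thesis
      using r0(2,5) b0 unfolding Ground_def by (auto simp: subst_magic_rule[symmetric])
  qed
qed

lemma GD_edb:
  assumes "r \<in> G" "a \<in> head r" "edb_pred P (pred a)"
  shows "r \<in> GD"
proof -
  have "EDB P \<subseteq> DMS magic Q P" unfolding DMS_def Let_def by blast
  then show ?thesis using Ground_edb[OF assms] unfolding Ground_def by blast
qed

section \<open>Models of the rewriting\<close>

text \<open>The query seed and the magic rules have no negative body, so they survive in every
  reduct and derive \<open>K\<close> along \<open>idb_relevant\<close>.\<close>

lemma K_subset_model:
  assumes "is_model (reduct GD I) J"
  shows "K \<subseteq> J"
proof -
  have "magic_atom magic a \<in> J" if "a \<in> R" for a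
    using that
  proof (induction rule: idb_relevant.induct)
    case query
    then show ?case using assms GD_query unfolding is_model_reduct_iff by fastforce
  next
    case (rule r a b)
    show ?case
    proof (cases "b = a")
      case False
      then have "magic_rule magic a b \<in> GD" using GD_rules(1) rule by blast
      then show ?thesis using assms rule.IH unfolding is_model_reduct_iff by fastforce
    qed (use rule in simp)
  qed
  then show ?thesis by blast
qed

lemma magic_rule_holds_in_K:
  assumes "r \<in> G" "a \<in> head r" "b \<in> atoms r" "idb_pred P (pred b)" "magic_atom magic a \<in> K"
  shows "magic_atom magic b \<in> K"
proof -
  have "pname a \<in> names" using Ground_pname assms(1,2) unfolding atoms_def by blast
  then show ?thesis using magic_atom_in_K_iff assms idb_relevant.rule by blast
qed

lemma model_shrink_magic:
  assumes J: "is_model (reduct GD I) J"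
  shows "is_model (reduct GD I) ((J - magic_atoms) \<union> K)"
  unfolding is_model_reduct_iff
proof (intro ballI impI)
  let ?J = "(J - magic_atoms) \<union> K"
  fix r assume r: "r \<in> GD" "neg_body r \<inter> I = {}" "pos_body r \<subseteq> ?J"
  have "pos_body r \<subseteq> J" using K_subset_model[OF J] r(3) by blast
  then have hJ: "head r \<inter> J \<noteq> {}" using is_model_reductD[OF J r(1,2)] by blast
  from r(1) show "head r \<inter> ?J \<noteq> {}"
  proof (cases rule: GD_cases)
    case query
    then show ?thesis using idb_relevant.query by auto
  next
    case (magic r' a b)
    have "magic_atom magic a \<in> magic_atoms"
      using magic Ground_pname[of r' U P a] unfolding magic_atoms_def magic_atom_def atoms_def by auto
    then have "magic_atom magic a \<in> K" using r magic by auto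
    then show ?thesis using magic_rule_holds_in_K magic by auto
  next
    case (modified r')
    then show ?thesis using hJ G_nonmagic[of r'] unfolding atoms_def by auto
  next
    case edb
    then show ?thesis using hJ G_nonmagic[of r] unfolding atoms_def bottom_def by auto
  qed
qed

text \<open>With \<open>K\<close> as the magic part, a modified rule is blocked unless its whole
  head is relevant, and otherwise acts as the original rule. The set \<open>I\<close> is arbitrary,
  so the reduct can stay fixed while smaller models are compared.\<close>

lemma model_GD_iff:
  assumes X: "X \<inter> magic_atoms = {}"
  shows "is_model (reduct GD I) (X \<union> K) \<longleftrightarrow> is_model (reduct GB I) X"
proof
  assume J: "is_model (reduct GD I) (X \<union> K)"
  show "is_model (reduct GB I) X"
    unfolding is_model_reduct_iff
  proof (intro ballI impI)
    fix r assume r: "r \<in> GB" "neg_body r \<inter> I = {}" "pos_body r \<subseteq> X"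
    then have rG: "r \<in> G" unfolding bottom_def by simp
    obtain a where a: "a \<in> head r" using Ground_head(1)[OF program rG] by blast
    then have "a \<in> split_set U P Q" using r unfolding bottom_def by blast
    then consider "a \<in> R" | "edb_pred P (pred a)" unfolding split_set_def by blast
    then have "head r \<inter> (X \<union> K) \<noteq> {}"
    proof cases
      case 1
      then have "modified_rule magic r \<in> GD" "head r \<subseteq> R"
        using GD_rules(2) head_in_R rG a by blast+
      moreover from this have "pos_body (modified_rule magic r) \<subseteq> X \<union> K" using r(3) by auto
      ultimately show ?thesis
        using is_model_reductD[OF J, of "modified_rule magic r"] r(2) by simp
    next
      case 2
      then have "r \<in> GD" using GD_edb rG a by blast
      moreover have "pos_body r \<subseteq> X \<union> K" using r(3) by blast
      ultimately show ?thesis using is_model_reductD[OF J] r(2) by blast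
    qed
    then show "head r \<inter> X \<noteq> {}" using G_nonmagic[OF rG] K_magic unfolding atoms_def by blast
  qed
next
  assume B: "is_model (reduct GB I) X"
  show "is_model (reduct GD I) (X \<union> K)"
    unfolding is_model_reduct_iff
  proof (intro ballI impI)
    fix r assume r: "r \<in> GD" "neg_body r \<inter> I = {}" "pos_body r \<subseteq> X \<union> K"
    from r(1) show "head r \<inter> (X \<union> K) \<noteq> {}"
    proof (cases rule: GD_cases)
      case query
      then show ?thesis using idb_relevant.query by auto
    next
      case (magic r' a b)
      have "magic_atom magic a \<in> magic_atoms"
        using magic Ground_pname[of r' U P a] unfolding magic_atoms_def magic_atom_def atoms_def
        by auto
      then have "magic_atom magic a \<in> K" using r magic X by auto
      then show ?thesis using magic_rule_holds_in_K magic by auto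
    next
      case (modified r')
      have nonmagic: "atoms r' \<inter> magic_atoms = {}" using G_nonmagic modified by blast
      then have pos: "pos_body r' \<subseteq> X" using r(3) modified K_magic unfolding atoms_def by fastforce
      \<comment> \<open>The added body atoms hold in \<open>X \<union> K\<close> and
        \<open>X\<close> has no magic atoms, so they must come from \<open>K\<close>.\<close>
      have "a \<in> R" if a: "a \<in> head r'" for a
      proof -
        have n: "pname a \<in> names" using Ground_pname modified a unfolding atoms_def by blast
        then have "magic_atom magic a \<in> magic_atoms"
          unfolding magic_atoms_def magic_atom_def by auto
        then have "magic_atom magic a \<in> K" using r modified a X by auto
        then show ?thesis using magic_atom_in_K_iff n by blast
      qed
      then have "r' \<in> GB" using modified unfolding bottom_def split_set_def by blast
      then have "head r' \<inter> X \<noteq> {}" using is_model_reductD[OF B] pos r(2) modified by simp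
      then show ?thesis using modified by auto
    next
      case edb
      then have "atoms r \<inter> magic_atoms = {}" using G_nonmagic unfolding bottom_def by simp
      then have "pos_body r \<subseteq> X" using r(3) K_magic unfolding atoms_def by blast
      then show ?thesis using is_model_reductD[OF B edb] r(2) by blast
    qed
  qed
qed

lemma reduct_GB_Un_K: "reduct GB (X \<union> K) = reduct GB X"
  by (rule reduct_cong) (use G_nonmagic K_magic in \<open>auto simp: bottom_def atoms_def\<close>)

lemma stable_GB_nonmagic: "stable GB X \<Longrightarrow> X \<inter> magic_atoms = {} \<and> X \<subseteq> split_set U P Q"
  using stable_subset_heads[of GB X] G_nonmagic unfolding bottom_def atoms_def by blast

section \<open>Transfer of stable models\<close>

lemma stable_GD_of_GB:
  assumes "stable GB X"
  shows "stable GD (X \<union> K)"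
proof -
  have X: "X \<inter> magic_atoms = {}" using stable_GB_nonmagic assms by blast
  have "is_model (reduct GD (X \<union> K)) (X \<union> K)"
    using assms unfolding model_GD_iff[OF X] reduct_GB_Un_K stable_def by blast
  moreover have "\<not> is_model (reduct GD (X \<union> K)) N" if N: "N \<subset> X \<union> K" for N
  proof
    assume mod: "is_model (reduct GD (X \<union> K)) N"
    \<comment> \<open>Every model contains \<open>K\<close>, so a smaller one can differ only in its
      nonmagic part.\<close>
    have eq: "N = (N - magic_atoms) \<union> K" using K_subset_model[OF mod] N X K_magic by blast
    have "is_model (reduct GD (X \<union> K)) ((N - magic_atoms) \<union> K)" using mod eq by simp
    then have "is_model (reduct GB X) (N - magic_atoms)"
      by (subst (asm) model_GD_iff) (auto simp: reduct_GB_Un_K)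
    moreover have "N - magic_atoms \<subset> X" using eq N X K_magic by blast
    ultimately show False using assms unfolding stable_def by blast
  qed
  ultimately show ?thesis unfolding stable_def by blast
qed

lemma stable_GB_of_GD:
  assumes M: "stable GD M"
  shows "stable GB (M - magic_atoms)"
proof -
  let ?X = "M - magic_atoms"
  have X: "?X \<inter> magic_atoms = {}" by blast
  have mod: "is_model (reduct GD M) M" using M unfolding stable_def by blast
  have "?X \<union> K \<subseteq> M" using K_subset_model[OF mod] by blast
  \<comment> \<open>Minimality of \<open>M\<close> against its shrunk version leaves no magic atom
    outside \<open>K\<close>.\<close>
  then have eq: "M = ?X \<union> K"
    using model_shrink_magic[OF mod] M unfolding stable_def by blast
  have red: "reduct GB M = reduct GB ?X" using reduct_GB_Un_K[of ?X] eq by simp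
  have "is_model (reduct GB ?X) ?X"
    using mod model_GD_iff[OF X, of M] eq red by simp
  moreover have "\<not> is_model (reduct GB ?X) N" if N: "N \<subset> ?X" for N
  proof
    assume "is_model (reduct GB ?X) N"
    moreover have "N \<inter> magic_atoms = {}" using N by blast
    ultimately have "is_model (reduct GD M) (N \<union> K)" using model_GD_iff red by simp
    moreover have "N \<union> K \<subset> M" using N eq K_magic by blast
    ultimately show False using M unfolding stable_def by blast
  qed
  ultimately show ?thesis unfolding stable_def by blast
qed

lemma stable_G_imp_GD:
  assumes "stable G M"
  shows "\<exists>M'. stable GD M' \<and> (Q \<in> M' \<longleftrightarrow> Q \<in> M)"
proof -
  have "stable GB (M \<inter> split_set U P Q)"
    by (rule stable_bottom[OF split_set_closed Ground_head(1)[OF program] assms])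
  then have "stable GD (M \<inter> split_set U P Q \<union> K)" by (rule stable_GD_of_GB)
  moreover have "Q \<in> split_set U P Q" "Q \<notin> K"
    using idb_relevant.query Q_nonmagic K_magic unfolding split_set_def by blast+
  ultimately show ?thesis by blast
qed

text \<open>The nonmagic part is stable for the bottom part and extends to all of \<open>G\<close>;
  since \<open>Q\<close> lies in the splitting set, its truth value is unchanged.\<close>

lemma stable_GD_imp_G:
  assumes "stratified P" "stable GD M"
  shows "\<exists>M'. stable G M' \<and> (Q \<in> M' \<longleftrightarrow> Q \<in> M)"
proof -
  have GB: "stable GB (M - magic_atoms)" using stable_GB_of_GD assms(2) by blast
  have "asp_fs P" using assms(1) program unfolding asp_fs_def by blast
  then obtain M' where "stable G M'" "M' \<inter> split_set U P Q = M - magic_atoms"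
    using stable_Ground_extend[OF _ split_set_closed GB] stable_GB_nonmagic[OF GB] by blast
  moreover have "Q \<in> split_set U P Q" using idb_relevant.query unfolding split_set_def by blast
  ultimately show ?thesis using Q_nonmagic by blast
qed

end

lemma funs_atom_magic_atom [simp]: "funs_atom (magic_atom magic a) = funs_atom a"
  unfolding funs_atom_def magic_atom_def by simp

text \<open>Ensures that the heads of the instantiated rewriting lie in its base over the universe
  of \<open>P\<close>.\<close>

lemma DMS_head_funs:
  assumes "is_program P" "is_query P Q" "r \<in> DMS magic Q P" "a \<in> head r"
  shows "funs_atom a \<subseteq> funs P"
proof -
  obtain D where "DMS magic Q P = insert (Rule {magic_atom magic Q} {} {})
      (magic_step magic P D) \<union> modified_step magic P D \<union> EDB P"
    using DMS_rules[OF assms(1)] by metis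
  then consider "a = magic_atom magic Q"
    | r' b where "r' \<in> P" "b \<in> atoms r'" "a = magic_atom magic b \<or> a = b"
    using assms(3,4) unfolding magic_step_def modified_step_def EDB_def atoms_def by fastforce
  then show ?thesis
  proof cases
    case 1
    then show ?thesis using assms(2) unfolding is_query_def by simp
  next
    case 2
    then show ?thesis using funs_atom_subset_funs[OF 2(1,2)] by auto
  qed
qed

theorem theorem3:
  fixes P :: "('p, 'f, 'v) program"
    and Q :: "('p, 'f, 'v) atom"
    and magic :: "'p \<Rightarrow> 'p"
    and c :: 'f
  defines "U \<equiv> universe c P"
  assumes "asp_fs P"
    and "is_query P Q"
    and "fresh_magic magic P Q"
    and "finitely_recursive U P Q"
  shows "(cautiously_entails U (DMS magic Q P) Q \<longleftrightarrow> cautiously_entails U P Q) \<and>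
         (bravely_entails U (DMS magic Q P) Q \<longleftrightarrow> bravely_entails U P Q)"
proof -
  have prog: "is_program P" "stratified P" using assms(2) unfolding asp_fs_def by auto
  interpret magic_sets U P Q magic
    using assms(3,4) prog(1) universe_nonempty[of c P]
    unfolding U_def is_query_def by unfold_locales blast+
  have G: "stable_model U P M \<longleftrightarrow> stable G M" for M
    unfolding U_def by (rule stable_model_iff, rule Ground_head_base)
      (auto simp: atoms_def dest: funs_atom_subset_funs)
  have GD: "stable_model U (DMS magic Q P) M \<longleftrightarrow> stable GD M" for M
    unfolding U_def by (rule stable_model_iff, rule Ground_head_base)
      (use DMS_head_funs[OF prog(1) assms(3)] in auto)
  \<comment> \<open>Each stable model on one side has a counterpart on the other with the same
    answer to \<open>Q\<close>, which settles both kinds of entailment.\<close>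
  show ?thesis
    unfolding cautiously_entails_def bravely_entails_def G GD
    using stable_G_imp_GD stable_GD_imp_G[OF prog(2)] by blast
qed

end
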